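(* Consider the generalized Sudoku problem with data $n, \pi_1, \pi_2, \pi_3, i_1, \ldots, i_k, g_{i_1}, \ldots, g_{i_k}$ and solution set $S(n,g)$, and let $x \in S(n, g)$. Then $S(n, g)$ equals the set of all $y \in \mathbb{Z}^{n^2}$ for which there exist permutations $\tau_1, \tau_2, \tau_3$ of $\{1, \ldots, n^2\}$ such that $y = \tau_r(x)$ for $r = 1, 2, 3$, $\tau_r$ is $\pi_r$-consistent for $r = 1, 2, 3$, and $\tau_r(i_l) = i_l$ for $l = 1, \ldots, k$ and $r = 1, 2, 3$.
   Context: For $y \in \mathbb{Z}^s$ write $y <> \mathbf{0}$ if every component of $y$ is nonzero. Let $n \ge 2$ and $s(n) = \sum_{i=1}^{n-1} i$. The $s(n) \times n$ matrix $A(n)$ is defined inductively: $A(1)$ is the empty matrix, and $A(m) = \begin{pmatrix} \mathbf{1}_{m-1} & -U_{m-1} \\ \mathbf{0}_{s(m-1)} & A(m-1) \end{pmatrix}$, where $\mathbf{1}_{m-1}$ is the all-ones column, $U_{m-1}$ the identity matrix and $\mathbf{0}_{s(m-1)}$ the zero column of length $s(m-1)$. Let $A$ be the $(n \cdot s(n)) \times n^2$ block-diagonal matrix whose $n$ diagonal blocks all equal $A(n)$. For a permutation $\pi$ of $\{1,\ldots,n^2\}$, $A_\pi$ is the matrix whose $j$-th column is the $\pi^{-1}(j)$-th column of $A$. For a permutation $\tau$ and $x \in \mathbb{Z}^{n^2}$, $\tau(x) = (x_{\tau^{-1}(1)}, \ldots, x_{\tau^{-1}(n^2)})^T$. The constraint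 sets of $\pi$ are $cs_\pi(j) = \{\pi(i) \mid (j-1)n + 1 \le i \le jn\}$, $j=1,\ldots,n$. A permutation $\tau$ is $\pi$-consistent if $\tau(cs_\pi(j)) = cs_\pi(j)$ for $j = 1,\ldots,n$. Generalized Sudoku problem: given permutations $\pi_1, \pi_2, \pi_3$ of $\{1, \ldots, n^2\}$, an integer $0 \le k \le n^2$, an index set $\{i_1, \ldots, i_k\} \subset \{1, \ldots, n^2\}$ and givens $g_{i_l} \in \mathbb{Z}$ with $1 \le g_{i_l} \le n$, its solution set is $S(n,g) = \{x \in \mathbb{Z}^{n^2} \mid 1 \le x_i \le n \ (i = 1,\ldots,n^2),\ A_{\pi_r}x <> \mathbf{0}\ (r = 1,2,3),\ x_{i_l} = g_{i_l}\ (l = 1, \ldots, k)\}$. *)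

theory Defs
  imports "Jordan_Normal_Form.Matrix" "HOL-Combinatorics.Permutations"
begin

text \<open>
  Positions, rows, columns and constraint sets are numbered from 0, following the indexing of
  \<^typ>\<open>'a mat\<close> and \<^typ>\<open>'a vec\<close>: the index set \<open>{1,\<dots>,n\<^sup>2}\<close> becomes \<open>{..<n\<^sup>2}\<close>, and the
  \<open>j\<close>-th block \<open>{(j-1)n+1,\<dots>,jn}\<close> becomes \<open>{j*n..<(j+1)*n}\<close> for \<open>j < n\<close>. The cell values are
  not shifted; they range over \<open>1,\<dots>,n\<close>.
\<close>

definition nowhere_zero :: "int vec \<Rightarrow> bool" where
  "nowhere_zero y \<longleftrightarrow> (\<forall>i<dim_vec y. y $ i \<noteq> 0)"

definition pair_count :: "nat \<Rightarrow> nat" where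
  "pair_count n = (\<Sum>i=1..n-1. i)"

text \<open>The empty matrix for \<open>n = 1\<close> has no rows but one column; the value at \<open>0\<close> is a dummy.\<close>

fun pair_mat :: "nat \<Rightarrow> int mat" where
  "pair_mat 0 = 0\<^sub>m 0 0"
| "pair_mat (Suc 0) = 0\<^sub>m 0 1"
| "pair_mat (Suc (Suc m)) =
     four_block_mat (mat (Suc m) 1 (\<lambda>_. 1)) (- 1\<^sub>m (Suc m))
                    (0\<^sub>m (pair_count (Suc m)) 1)      (pair_mat (Suc m))"

definition block_mat :: "nat \<Rightarrow> int mat" where
  "block_mat n = diag_block_mat (replicate n (pair_mat n))"

text \<open>
  \<open>inv_into UNIV\<close> is the functional inverse; the notation \<open>inv\<close> is ambiguous here, being shared with
  the group inverse of HOL-Algebra.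
\<close>

definition permute_cols :: "(nat \<Rightarrow> nat) \<Rightarrow> 'a mat \<Rightarrow> 'a mat" where
  "permute_cols \<pi> M = mat (dim_row M) (dim_col M) (\<lambda>(i, j). M $$ (i, inv_into UNIV \<pi> j))"

definition permute_vec :: "(nat \<Rightarrow> nat) \<Rightarrow> 'a vec \<Rightarrow> 'a vec" where
  "permute_vec \<tau> x = vec (dim_vec x) (\<lambda>j. x $ inv_into UNIV \<tau> j)"

definition constraint_set :: "nat \<Rightarrow> (nat \<Rightarrow> nat) \<Rightarrow> nat \<Rightarrow> nat set" where
  "constraint_set n \<pi> j = \<pi> ` {j*n..<(j+1)*n}"

definition consistent :: "nat \<Rightarrow> (nat \<Rightarrow> nat) \<Rightarrow> (nat \<Rightarrow> nat) \<Rightarrow> bool" where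
  "consistent n \<pi> \<tau> \<longleftrightarrow> (\<forall>j<n. \<tau> ` constraint_set n \<pi> j = constraint_set n \<pi> j)"

text \<open>
  \<open>\<pi> r\<close> for \<open>r \<in> {1, 2, 3}\<close> are the three permutations, \<open>idx l\<close> for \<open>l \<in> {1..k}\<close> the indices of
  the given cells, and \<open>g p\<close> is the given value of cell \<open>p\<close>.
\<close>

definition sudoku_solutions ::
  "nat \<Rightarrow> (nat \<Rightarrow> nat \<Rightarrow> nat) \<Rightarrow> nat \<Rightarrow> (nat \<Rightarrow> nat) \<Rightarrow> (nat \<Rightarrow> int) \<Rightarrow> int vec set" where
  "sudoku_solutions n \<pi> k idx g =
     {x \<in> carrier_vec (n^2).
        (\<forall>i<n^2. 1 \<le> x $ i \<and> x $ i \<le> int n) \<and>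
        (\<forall>r\<in>{1,2,3}. nowhere_zero (permute_cols (\<pi> r) (block_mat n) *\<^sub>v x)) \<and>
        (\<forall>l\<in>{1..k}. x $ idx l = g (idx l))}"

lemma pair_count_Suc: "pair_count (Suc m) = m + pair_count m"
  by (cases m) (simp_all add: pair_count_def)

lemma pair_mat_carrier: "pair_mat n \<in> carrier_mat (pair_count n) n"
proof (induction n rule: pair_mat.induct)
  case (3 m)
  then show ?case
    by (auto simp: pair_count_Suc[of "Suc m"])
qed (auto simp: pair_count_def)

lemma block_mat_carrier: "block_mat n \<in> carrier_mat (n * pair_count n) (n^2)"
  using pair_mat_carrier[of n]
  by (auto simp: block_mat_def dim_diag_block_mat sum_list_replicate power2_eq_square)

end

theory Submission
  imports Defs
begin

text \<open>
  The rows of \<open>pair_mat n\<close> compute the differences \<open>v\<^sub>a - v\<^sub>b\<close> for \<open>a < b\<close>, so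
  \<open>A\<^sub>\<pi> x\<close> has no zero component iff \<open>x\<close> is injective on every constraint set of
  \<open>\<pi>\<close>. With values in \<open>{1,\<dots>,n}\<close> this means that every solution restricts to a bijection from
  each constraint set onto \<open>{1,\<dots>,n}\<close>. Two solutions \<open>x\<close> and \<open>y\<close> therefore determine, on each
  constraint set, the permutation sending \<open>p\<close> to the unique \<open>q\<close> with \<open>y\<^sub>q = x\<^sub>p\<close>; glued together
  these give the consistent permutation, which fixes every cell where \<open>x\<close> and \<open>y\<close> agree, in
  particular the givens.
\<close>

section \<open>Nonvanishing of products with the block matrices\<close>

lemma nowhere_zero_append:
  "nowhere_zero (v @\<^sub>v w) \<longleftrightarrow> nowhere_zero v \<and> nowhere_zero w"
proof
  assume L: "nowhere_zero (v @\<^sub>v w)"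
  have "v $ i \<noteq> 0" if "i < dim_vec v" for i
    using L[unfolded nowhere_zero_def, rule_format, of i] that by simp
  moreover have "w $ i \<noteq> 0" if "i < dim_vec w" for i
    using L[unfolded nowhere_zero_def, rule_format, of "dim_vec v + i"] that by simp
  ultimately show "nowhere_zero v \<and> nowhere_zero w"
    by (simp add: nowhere_zero_def)
qed (auto simp: nowhere_zero_def)

text \<open>Induction along the recursion of \<open>pair_mat\<close>: the upper blocks compare the
  head of \<open>v\<close> with every later entry, and the lower blocks apply the smaller matrix to
  the tail. The two conditions together are injectivity on the head inserted into the tail.\<close>

lemma nowhere_zero_pair_mat_mult:
  assumes "v \<in> carrier_vec n"
  shows "nowhere_zero (pair_mat n *\<^sub>v v) \<longleftrightarrow> inj_on (\<lambda>i. v $ i) {..<n}"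
  using assms
proof (induction n arbitrary: v rule: pair_mat.induct)
  case (3 m)
  define a d where "a = vec_first v 1" and "d = vec_last v (Suc m)"
  have a: "a \<in> carrier_vec 1" and d: "d \<in> carrier_vec (Suc m)"
    by (auto simp: a_def d_def)
  have v: "v = a @\<^sub>v d"
    using 3(2) by (simp add: a_def d_def)
  have v0: "v $ 0 = a $ 0" and vS: "v $ Suc i = d $ i" if "i < Suc m" for i
    using a d that by (simp_all add: v)
  let ?first = "mat (Suc m) 1 (\<lambda>_. 1) *\<^sub>v a + - 1\<^sub>m (Suc m) *\<^sub>v d"
  have first: "?first $ i = v $ 0 - v $ Suc i" if "i < Suc m" for i
  proof -
    have "(mat (Suc m) 1 (\<lambda>_. 1) *\<^sub>v a) $ i = a $ 0"
      using a that by (auto simp: scalar_prod_def)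
    moreover have "(- 1\<^sub>m (Suc m) *\<^sub>v d) $ i = - d $ i"
      using d that by simp
    ultimately show ?thesis
      using d that v0[OF that] vS[OF that] by simp
  qed
  have "pair_mat (Suc (Suc m)) *\<^sub>v v =
      ?first @\<^sub>v (0\<^sub>m (pair_count (Suc m)) 1 *\<^sub>v a + pair_mat (Suc m) *\<^sub>v d)"
    unfolding v pair_mat.simps
    by (rule four_block_mat_mult_vec[OF _ _ _ pair_mat_carrier a d]) auto
  \<comment> \<open>The zero column removes the head \<open>a\<close> from the lower half, so the
    induction hypothesis applies to the tail \<open>d\<close>.\<close>
  also have "0\<^sub>m (pair_count (Suc m)) 1 *\<^sub>v a + pair_mat (Suc m) *\<^sub>v d = pair_mat (Suc m) *\<^sub>v d"
    using a d pair_mat_carrier[of "Suc m"] by auto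
  finally have "nowhere_zero (pair_mat (Suc (Suc m)) *\<^sub>v v) \<longleftrightarrow>
      nowhere_zero ?first \<and> inj_on (\<lambda>i. d $ i) {..<Suc m}"
    using 3(1)[OF d] by (simp add: nowhere_zero_append)
  also have "nowhere_zero ?first \<longleftrightarrow> (\<forall>i<Suc m. v $ 0 \<noteq> v $ Suc i)"
    unfolding nowhere_zero_def using first by auto
  also have "inj_on (\<lambda>i. d $ i) {..<Suc m} \<longleftrightarrow> inj_on (\<lambda>i. v $ Suc i) {..<Suc m}"
    by (rule inj_on_cong) (simp add: vS)
  also have "\<dots> \<longleftrightarrow> inj_on (\<lambda>i. v $ i) (Suc ` {..<Suc m})"
    by (simp add: inj_on_def)
  also have "(\<forall>i<Suc m. v $ 0 \<noteq> v $ Suc i) \<and> inj_on (\<lambda>i. v $ i) (Suc ` {..<Suc m})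
      \<longleftrightarrow> inj_on (\<lambda>i. v $ i) (insert 0 (Suc ` {..<Suc m}))"
    by (auto simp: inj_on_insert)
  also have "insert 0 (Suc ` {..<Suc m}) = {..<Suc (Suc m)}"
    by (simp only: lessThan_Suc_eq_insert_0)
  finally show ?case .
qed (auto simp: nowhere_zero_def inj_on_def)

lemma block_index_less:
  fixes i j m c :: nat
  assumes "j < m" and "i < c"
  shows "j * c + i < m * c"
proof -
  have "j * c + i < Suc j * c"
    using assms by simp
  also have "\<dots> \<le> m * c"
    using assms by (intro mult_le_mono1) simp
  finally show ?thesis .
qed

text \<open>The zero off-diagonal blocks decouple the segments of length \<open>c\<close>. Induction
  on \<open>m\<close> splits off the first segment; segment \<open>j\<close> of the remainder is
  segment \<open>Suc j\<close> of \<open>v\<close>, so \<open>v\<close> has to vary in the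
  induction.\<close>

lemma nowhere_zero_diag_block_mat_mult:
  assumes A: "A \<in> carrier_mat r c" and "v \<in> carrier_vec (m * c)"
  shows "nowhere_zero (diag_block_mat (replicate m A) *\<^sub>v v) \<longleftrightarrow>
    (\<forall>j<m. nowhere_zero (A *\<^sub>v vec c (\<lambda>i. v $ (j * c + i))))"
  using assms(2)
proof (induction m arbitrary: v)
  case 0
  then show ?case by (simp add: nowhere_zero_def)
next
  case (Suc m)
  define a d where "a = vec_first v c" and "d = vec_last v (m * c)"
  let ?D = "diag_block_mat (replicate m A)"
  have D: "?D \<in> carrier_mat (m * r) (m * c)"
    using A by (auto simp: dim_diag_block_mat sum_list_replicate)
  have a: "a \<in> carrier_vec c" and d: "d \<in> carrier_vec (m * c)"
    by (auto simp: a_def d_def)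
  have v: "v = a @\<^sub>v d"
    using Suc(2) by (simp add: a_def d_def)
  have a_eq: "a = vec c (\<lambda>i. v $ (0 * c + i))"
    using a by (auto simp: v)
  have d_eq: "vec c (\<lambda>i. d $ (j * c + i)) = vec c (\<lambda>i. v $ (Suc j * c + i))" if "j < m" for j
  proof (rule eq_vecI)
    fix i assume "i < dim_vec (vec c (\<lambda>i. v $ (Suc j * c + i)))"
    then have "i < c" by simp
    have "j * c + i < m * c"
      using block_index_less that \<open>i < c\<close> by blast
    then show "vec c (\<lambda>i. d $ (j * c + i)) $ i = vec c (\<lambda>i. v $ (Suc j * c + i)) $ i"
      using a d \<open>i < c\<close> by (simp add: v add.assoc)
  qed simp
  have "diag_block_mat (replicate (Suc m) A) *\<^sub>v v = A *\<^sub>v a @\<^sub>v ?D *\<^sub>v d"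
    unfolding v replicate_Suc diag_block_mat.simps Let_def
    by (subst four_block_mat_mult_vec[OF A _ _ D a d]) (use A D a d in auto)
  then have "nowhere_zero (diag_block_mat (replicate (Suc m) A) *\<^sub>v v) \<longleftrightarrow>
      nowhere_zero (A *\<^sub>v a) \<and> (\<forall>j<m. nowhere_zero (A *\<^sub>v vec c (\<lambda>i. d $ (j * c + i))))"
    by (simp add: nowhere_zero_append Suc.IH[OF d])
  also have "\<dots> \<longleftrightarrow> nowhere_zero (A *\<^sub>v vec c (\<lambda>i. v $ (0 * c + i))) \<and>
      (\<forall>j<m. nowhere_zero (A *\<^sub>v vec c (\<lambda>i. v $ (Suc j * c + i))))"
    using a_eq d_eq by simp
  finally show ?case
    by (simp only: All_less_Suc2)
qed

section \<open>Column permutations and constraint sets\<close>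

text \<open>Reindexing the scalar product of each row by \<pi> moves the permutation from the
  columns of the matrix to the entries of the vector.\<close>

lemma permute_cols_mult_vec:
  assumes "\<pi> permutes {..<dim_col M}" and "x \<in> carrier_vec (dim_col M)"
  shows "permute_cols \<pi> M *\<^sub>v x = M *\<^sub>v vec (dim_col M) (\<lambda>i. x $ \<pi> i)"
proof (rule eq_vecI)
  fix i assume "i < dim_vec (M *\<^sub>v vec (dim_col M) (\<lambda>i. x $ \<pi> i))"
  then have i: "i < dim_row M" by simp
  have "(permute_cols \<pi> M *\<^sub>v x) $ i =
      (\<Sum>j<dim_col M. M $$ (i, inv_into UNIV \<pi> j) * x $ j)"
    using i assms(2) by (simp add: permute_cols_def scalar_prod_def lessThan_atLeast0)
  also have "\<dots> = (\<Sum>j<dim_col M. M $$ (i, j) * x $ \<pi> j)"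
    by (subst sum.permute[OF assms(1)]) (simp add: permutes_inverses[OF assms(1)])
  also have "\<dots> = (M *\<^sub>v vec (dim_col M) (\<lambda>i. x $ \<pi> i)) $ i"
    using i by (simp add: scalar_prod_def lessThan_atLeast0)
  finally show "(permute_cols \<pi> M *\<^sub>v x) $ i = (M *\<^sub>v vec (dim_col M) (\<lambda>i. x $ \<pi> i)) $ i" .
qed (simp add: permute_cols_def)

text \<open>After the permutation is moved to the vector, block \<open>j\<close> sees exactly the
  entries of \<open>x\<close> at \<open>\<pi> (j * n + i)\<close> for \<open>i < n\<close>. These
  positions form the constraint set, and since \<pi> is injective, injectivity in \<open>i\<close>
  is injectivity on that set.\<close>

lemma nowhere_zero_permute_cols_block_mat:
  assumes \<pi>: "\<pi> permutes {..<n^2}" and x: "x \<in> carrier_vec (n^2)"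
  shows "nowhere_zero (permute_cols \<pi> (block_mat n) *\<^sub>v x) \<longleftrightarrow>
    (\<forall>j<n. inj_on (\<lambda>i. x $ i) (constraint_set n \<pi> j))"
proof -
  have dim: "dim_col (block_mat n) = n^2"
    using block_mat_carrier[of n] by simp
  let ?x = "vec (n * n) (\<lambda>i. x $ \<pi> i)"
  have mult: "permute_cols \<pi> (block_mat n) *\<^sub>v x = block_mat n *\<^sub>v ?x"
    using permute_cols_mult_vec[of \<pi> "block_mat n" x] \<pi> x
    by (simp add: dim power2_eq_square)
  have "nowhere_zero (permute_cols \<pi> (block_mat n) *\<^sub>v x) \<longleftrightarrow>
      (\<forall>j<n. nowhere_zero (pair_mat n *\<^sub>v vec n (\<lambda>i. ?x $ (j * n + i))))"
    unfolding mult unfolding block_mat_def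
    by (rule nowhere_zero_diag_block_mat_mult[OF pair_mat_carrier]) simp
  also have "\<dots> \<longleftrightarrow> (\<forall>j<n. inj_on (\<lambda>i. x $ \<pi> (j * n + i)) {..<n})"
  proof (intro all_cong)
    fix j assume "j < n"
    have "nowhere_zero (pair_mat n *\<^sub>v vec n (\<lambda>i. ?x $ (j * n + i))) \<longleftrightarrow>
        inj_on (\<lambda>i. vec n (\<lambda>i. ?x $ (j * n + i)) $ i) {..<n}"
      by (rule nowhere_zero_pair_mat_mult) simp
    also have "\<dots> \<longleftrightarrow> inj_on (\<lambda>i. x $ \<pi> (j * n + i)) {..<n}"
      by (rule inj_on_cong) (simp add: block_index_less[OF \<open>j < n\<close>])
    finally show "nowhere_zero (pair_mat n *\<^sub>v vec n (\<lambda>i. ?x $ (j * n + i))) \<longleftrightarrow>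
        inj_on (\<lambda>i. x $ \<pi> (j * n + i)) {..<n}" .
  qed
  also have "\<dots> \<longleftrightarrow> (\<forall>j<n. inj_on (\<lambda>i. x $ i) (constraint_set n \<pi> j))"
  proof (intro all_cong)
    fix j
    have inj: "inj_on (\<lambda>i. \<pi> (j * n + i)) {..<n}"
      using permutes_inj[OF \<pi>] by (auto intro!: inj_onI dest!: injD)
    have "{j * n..<(j + 1) * n} = (\<lambda>i. j * n + i) ` {..<n}"
      by (simp add: lessThan_atLeast0 add.commute)
    then have "constraint_set n \<pi> j = (\<lambda>i. \<pi> (j * n + i)) ` {..<n}"
      by (simp add: constraint_set_def image_image)
    then show "inj_on (\<lambda>i. x $ \<pi> (j * n + i)) {..<n} \<longleftrightarrow>
        inj_on (\<lambda>i. x $ i) (constraint_set n \<pi> j)"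
      using comp_inj_on_iff[OF inj, of "\<lambda>i. x $ i"] by (simp add: o_def)
  qed
  finally show ?thesis .
qed

section \<open>The constraint sets as a partition of the cells\<close>

lemma constraint_set_disjoint:
  assumes "\<pi> permutes S" and "i \<noteq> j"
  shows "constraint_set n \<pi> i \<inter> constraint_set n \<pi> j = {}"
proof -
  \<comment> \<open>Division by \<open>n\<close> recovers the block number, so no position lies in
    two blocks; injectivity of \<pi> carries this over to the images.\<close>
  have "q div n = j" if "q \<in> {j * n..<(j + 1) * n}" for q j
    using that by (intro div_nat_eqI) (auto simp: mult.commute)
  then have "{i * n..<(i + 1) * n} \<inter> {j * n..<(j + 1) * n} = {}"
    using \<open>i \<noteq> j\<close> by blast
  then show ?thesis
    using permutes_inj[OF assms(1)] unfolding constraint_set_def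
    by (metis image_Int image_empty)
qed

lemma Union_constraint_set:
  assumes "\<pi> permutes {..<n^2}"
  shows "(\<Union>j<n. constraint_set n \<pi> j) = {..<n^2}"
proof -
  have "(\<Union>j<n. {j * n..<(j + 1) * n}) = {..<n^2}"
  proof (intro equalityI subsetI)
    fix q assume "q \<in> {..<n^2}"
    then have q: "q < n * n" by (simp add: power2_eq_square)
    \<comment> \<open>Positivity makes \<open>q div n\<close> the true block number; division by
      zero would return the default value 0.\<close>
    then have "0 < n" by (cases n) auto
    then have "q \<in> {q div n * n..<(q div n + 1) * n}"
      using dividend_less_div_times[of n q] by (simp add: add.commute)
    moreover have "q div n < n"
      using q by (simp add: less_mult_imp_div_less)
    ultimately show "q \<in> (\<Union>j<n. {j * n..<(j + 1) * n})" by blast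
  next
    fix q assume "q \<in> (\<Union>j<n. {j * n..<(j + 1) * n})"
    then obtain j where "j < n" "q < (j + 1) * n" by auto
    moreover have "(j + 1) * n \<le> n * n"
      using \<open>j < n\<close> by (intro mult_le_mono1) simp
    ultimately show "q \<in> {..<n^2}" by (simp add: power2_eq_square)
  qed
  then show ?thesis
    by (simp add: constraint_set_def permutes_image[OF assms] flip: image_UN)
qed

lemma card_constraint_set:
  assumes "\<pi> permutes S"
  shows "card (constraint_set n \<pi> j) = n"
  unfolding constraint_set_def
  using card_image[OF inj_on_subset[OF permutes_inj[OF assms] subset_UNIV]] by simp

section \<open>Consistent permutations and solutions\<close>

text \<open>The permuted vector has at \<open>\<tau> i\<close> the value of \<open>x\<close> at
  \<open>i\<close>, so injectivity of \<open>x\<close> on a constraint set passes to its image under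
  \<tau>, which by consistency is the same set.\<close>

lemma nowhere_zero_permute_vec:
  assumes \<pi>: "\<pi> permutes {..<n^2}" and \<tau>: "\<tau> permutes {..<n^2}"
    and cons: "consistent n \<pi> \<tau>" and x: "x \<in> carrier_vec (n^2)"
    and nz: "nowhere_zero (permute_cols \<pi> (block_mat n) *\<^sub>v x)"
  shows "nowhere_zero (permute_cols \<pi> (block_mat n) *\<^sub>v permute_vec \<tau> x)"
proof -
  have "inj_on (\<lambda>i. permute_vec \<tau> x $ i) (constraint_set n \<pi> j)" if "j < n" for j
  proof -
    let ?C = "constraint_set n \<pi> j"
    have C: "?C \<subseteq> {..<n^2}"
      using Union_constraint_set[OF \<pi>] that by blast
    have inj: "inj_on (\<lambda>i. x $ i) ?C"
      using nz nowhere_zero_permute_cols_block_mat[OF \<pi> x] that by blast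
    have "permute_vec \<tau> x $ \<tau> i = x $ i" if "i \<in> ?C" for i
    proof -
      have "\<tau> i < n^2"
        using permutes_in_image[OF \<tau>, of i] C that by auto
      then show ?thesis
        using x by (simp add: permute_vec_def permutes_inverses[OF \<tau>])
    qed
    then have "inj_on ((\<lambda>i. permute_vec \<tau> x $ i) \<circ> \<tau>) ?C"
      using inj by (simp add: inj_on_def)
    then have "inj_on (\<lambda>i. permute_vec \<tau> x $ i) (\<tau> ` ?C)"
      by (rule inj_on_imageI)
    then show ?thesis
      using cons that by (simp add: consistent_def)
  qed
  moreover have "permute_vec \<tau> x \<in> carrier_vec (n^2)"
    using x by (intro carrier_vecI) (simp add: permute_vec_def)
  ultimately show ?thesis
    using nowhere_zero_permute_cols_block_mat[OF \<pi>] by blast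
qed

text \<open>Pigeonhole: \<open>n\<close> cells with distinct values among \<open>n\<close> numbers
  take every one of these values.\<close>

lemma bij_betw_constraint_set:
  assumes \<pi>: "\<pi> permutes {..<n^2}" and x: "x \<in> carrier_vec (n^2)"
    and range: "\<forall>i<n^2. 1 \<le> x $ i \<and> x $ i \<le> int n"
    and nz: "nowhere_zero (permute_cols \<pi> (block_mat n) *\<^sub>v x)" and "j < n"
  shows "bij_betw (\<lambda>i. x $ i) (constraint_set n \<pi> j) {1..int n}"
proof -
  let ?C = "constraint_set n \<pi> j"
  have inj: "inj_on (\<lambda>i. x $ i) ?C"
    using nz nowhere_zero_permute_cols_block_mat[OF \<pi> x] \<open>j < n\<close> by blast
  have "?C \<subseteq> {..<n^2}"
    using Union_constraint_set[OF \<pi>] \<open>j < n\<close> by blast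
  then have "(\<lambda>i. x $ i) ` ?C \<subseteq> {1..int n}"
    using range by auto
  moreover have "card ((\<lambda>i. x $ i) ` ?C) = card {1..int n}"
    by (simp add: card_image[OF inj] card_constraint_set[OF \<pi>])
  ultimately have "(\<lambda>i. x $ i) ` ?C = {1..int n}"
    by (intro card_subset_eq) auto
  with inj show ?thesis
    by (simp add: bij_betw_def)
qed

text \<open>On each constraint set, \<tau> is \<open>x\<close> followed by the inverse of
  \<open>y\<close>; as these sets partition the cells, the pieces glue. The last clause covers every
  cell where the vectors agree, and is later applied to the givens.\<close>

lemma ex_consistent_permutation:
  assumes \<pi>: "\<pi> permutes {..<n^2}"
    and x: "x \<in> carrier_vec (n^2)" and y: "y \<in> carrier_vec (n^2)"
    and bij_x: "\<And>j. j < n \<Longrightarrow> bij_betw (\<lambda>i. x $ i) (constraint_set n \<pi> j) V"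
    and bij_y: "\<And>j. j < n \<Longrightarrow> bij_betw (\<lambda>i. y $ i) (constraint_set n \<pi> j) V"
  shows "\<exists>\<tau>. \<tau> permutes {..<n^2} \<and> y = permute_vec \<tau> x \<and> consistent n \<pi> \<tau> \<and>
    (\<forall>p<n^2. x $ p = y $ p \<longrightarrow> \<tau> p = p)"
proof -
  let ?C = "constraint_set n \<pi>"
  have "\<exists>j<n. p \<in> ?C j" if "p < n^2" for p
    using Union_constraint_set[OF \<pi>] that by blast
  \<comment> \<open>The function \<open>b\<close> picks the constraint set containing a cell;
    disjointness makes this choice unique.\<close>
  then obtain b where b: "\<And>p. p < n^2 \<Longrightarrow> b p < n \<and> p \<in> ?C (b p)"
    by metis
  have b_eq: "b p = j" if "j < n" "p \<in> ?C j" for p j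
  proof -
    have "p < n^2"
      using Union_constraint_set[OF \<pi>] that by blast
    then show ?thesis
      using b[of p] constraint_set_disjoint[OF \<pi>, of "b p" j n] that by blast
  qed
  define \<sigma> where "\<sigma> j p = inv_into (?C j) (\<lambda>i. y $ i) (x $ p)" for j p
  \<comment> \<open>The identity beyond \<open>n^2\<close> is what \<open>permutes\<close> demands
    outside the index set.\<close>
  define \<tau> where "\<tau> p = (if p < n^2 then \<sigma> (b p) p else p)" for p
  have \<sigma>: "bij_betw (\<sigma> j) (?C j) (?C j)" if "j < n" for j
    using bij_betw_trans[OF bij_x[OF that] bij_betw_inv_into[OF bij_y[OF that]]]
    unfolding \<sigma>_def o_def .
  have y_\<sigma>: "y $ \<sigma> j p = x $ p" if "j < n" "p \<in> ?C j" for j p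
    unfolding \<sigma>_def
    using bij_betw_inv_into_right[OF bij_y[OF that(1)]] bij_betwE[OF bij_x[OF that(1)]] that(2)
    by blast
  have sub: "?C j \<subseteq> {..<n^2}" if "j < n" for j
    using Union_constraint_set[OF \<pi>] that by blast
  have \<tau>_\<sigma>: "\<tau> p = \<sigma> j p" if "j < n" "p \<in> ?C j" for j p
    using b_eq[OF that] sub[OF that(1)] that by (auto simp: \<tau>_def)
  have image: "\<tau> ` ?C j = ?C j" if "j < n" for j
    using bij_betw_imp_surj_on[OF \<sigma>[OF that]] \<tau>_\<sigma>[OF that] by (metis image_cong)
  have "\<tau> ` {..<n^2} = {..<n^2}"
    unfolding Union_constraint_set[OF \<pi>, symmetric] image_UN using image by simp
  \<comment> \<open>A surjection of a finite set onto itself is injective, so the image equation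
    gives bijectivity.\<close>
  then have perm: "\<tau> permutes {..<n^2}"
    by (intro bij_imp_permutes)
      (auto simp: bij_betw_def \<tau>_def intro!: eq_card_imp_inj_on)
  have y_\<tau>: "y $ \<tau> p = x $ p" if "p < n^2" for p
    using y_\<sigma>[of "b p" p] b[OF that] that by (simp add: \<tau>_def)
  have "y = permute_vec \<tau> x"
  proof (rule eq_vecI)
    fix q assume "q < dim_vec (permute_vec \<tau> x)"
    then have q: "q < n^2" using x by (simp add: permute_vec_def)
    then have "inv_into UNIV \<tau> q < n^2"
      using permutes_in_image[OF permutes_inv[OF perm], of q] by simp
    from y_\<tau>[OF this] show "y $ q = permute_vec \<tau> x $ q"
      using q x by (simp add: permute_vec_def permutes_inverses[OF perm])
  qed (use x y in \<open>simp add: permute_vec_def\<close>)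
  \<comment> \<open>If \<open>x\<close> and \<open>y\<close> agree at \<open>p\<close>, then
    \<open>p\<close> itself is the preimage under \<open>y\<close> that \<sigma> selects.\<close>
  moreover have "\<tau> p = p" if "p < n^2" "x $ p = y $ p" for p
    using bij_betw_inv_into_left[OF bij_y, of "b p" p] b[OF that(1)] that
    by (simp add: \<tau>_def \<sigma>_def)
  moreover have "consistent n \<pi> \<tau>"
    using image by (simp add: consistent_def)
  ultimately show ?thesis
    using perm by blast
qed

theorem theorem4p1:
  fixes n k :: nat
    and \<pi> :: "nat \<Rightarrow> nat \<Rightarrow> nat"
    and idx :: "nat \<Rightarrow> nat"
    and g :: "nat \<Rightarrow> int"
    and x :: "int vec"
  assumes "n \<ge> 2"
    and "\<forall>r\<in>{1,2,3}. \<pi> r permutes {..<n^2}"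
    and "k \<le> n^2"
    and "inj_on idx {1..k}"
    and "idx ` {1..k} \<subseteq> {..<n^2}"
    and "\<forall>l\<in>{1..k}. 1 \<le> g (idx l) \<and> g (idx l) \<le> int n"
    and "x \<in> sudoku_solutions n \<pi> k idx g"
  shows "sudoku_solutions n \<pi> k idx g =
    {y \<in> carrier_vec (n^2).
       \<exists>\<tau> :: nat \<Rightarrow> nat \<Rightarrow> nat.
         \<forall>r\<in>{1,2,3}. \<tau> r permutes {..<n^2} \<and>
           y = permute_vec (\<tau> r) x \<and>
           consistent n (\<pi> r) (\<tau> r) \<and>
           (\<forall>l\<in>{1..k}. \<tau> r (idx l) = idx l)}"
proof (intro equalityI subsetI)
  fix y assume y: "y \<in> sudoku_solutions n \<pi> k idx g"
  have "\<exists>\<tau>. \<tau> permutes {..<n^2} \<and> y = permute_vec \<tau> x \<and> consistent n (\<pi> r) \<tau> \<and>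
      (\<forall>p<n^2. x $ p = y $ p \<longrightarrow> \<tau> p = p)" if r: "r \<in> {1,2,3}" for r
  proof (rule ex_consistent_permutation)
    show "\<pi> r permutes {..<n^2}"
      using assms(2) r by blast
    show "bij_betw (\<lambda>i. x $ i) (constraint_set n (\<pi> r) j) {1..int n}" if "j < n" for j
      using assms(2,7) r that unfolding sudoku_solutions_def
      by (intro bij_betw_constraint_set) blast+
    show "bij_betw (\<lambda>i. y $ i) (constraint_set n (\<pi> r) j) {1..int n}" if "j < n" for j
      using assms(2) y r that unfolding sudoku_solutions_def
      by (intro bij_betw_constraint_set) blast+
  qed (use assms(7) y in \<open>simp_all add: sudoku_solutions_def\<close>)
  then obtain \<tau> where \<tau>: "\<forall>r\<in>{1,2,3}. \<tau> r permutes {..<n^2} \<and> y = permute_vec (\<tau> r) x \<and>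
      consistent n (\<pi> r) (\<tau> r) \<and> (\<forall>p<n^2. x $ p = y $ p \<longrightarrow> \<tau> r p = p)"
    by metis
  \<comment> \<open>Both solutions carry the value \<open>g (idx l)\<close> there, so the given
    cells are among those fixed by each \<open>\<tau> r\<close>.\<close>
  have "idx l < n^2 \<and> x $ idx l = y $ idx l" if "l \<in> {1..k}" for l
    using subsetD[OF assms(5) imageI[OF that]] assms(7) y that
    by (simp add: sudoku_solutions_def)
  with \<tau> have "\<forall>r\<in>{1,2,3}. \<tau> r permutes {..<n^2} \<and> y = permute_vec (\<tau> r) x \<and>
      consistent n (\<pi> r) (\<tau> r) \<and> (\<forall>l\<in>{1..k}. \<tau> r (idx l) = idx l)"
    by blast
  moreover have "y \<in> carrier_vec (n^2)"
    using y by (simp add: sudoku_solutions_def)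
  ultimately show "y \<in> {y \<in> carrier_vec (n^2). \<exists>\<tau> :: nat \<Rightarrow> nat \<Rightarrow> nat.
      \<forall>r\<in>{1,2,3}. \<tau> r permutes {..<n^2} \<and> y = permute_vec (\<tau> r) x \<and>
        consistent n (\<pi> r) (\<tau> r) \<and> (\<forall>l\<in>{1..k}. \<tau> r (idx l) = idx l)}"
    by blast
next
  fix y assume "y \<in> {y \<in> carrier_vec (n^2). \<exists>\<tau> :: nat \<Rightarrow> nat \<Rightarrow> nat.
      \<forall>r\<in>{1,2,3}. \<tau> r permutes {..<n^2} \<and> y = permute_vec (\<tau> r) x \<and>
        consistent n (\<pi> r) (\<tau> r) \<and> (\<forall>l\<in>{1..k}. \<tau> r (idx l) = idx l)}"
  then obtain \<tau> :: "nat \<Rightarrow> nat \<Rightarrow> nat" where y: "y \<in> carrier_vec (n^2)"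
    and \<tau>: "\<forall>r\<in>{1,2,3}. \<tau> r permutes {..<n^2} \<and> y = permute_vec (\<tau> r) x \<and>
      consistent n (\<pi> r) (\<tau> r) \<and> (\<forall>l\<in>{1..k}. \<tau> r (idx l) = idx l)"
    by blast
  have x: "x \<in> carrier_vec (n^2)" and range: "\<forall>i<n^2. 1 \<le> x $ i \<and> x $ i \<le> int n"
    and givens: "\<forall>l\<in>{1..k}. x $ idx l = g (idx l)"
    and nz: "\<forall>r\<in>{1,2,3}. nowhere_zero (permute_cols (\<pi> r) (block_mat n) *\<^sub>v x)"
    using assms(7) by (simp_all add: sudoku_solutions_def)
  \<comment> \<open>All three \<open>\<tau> r\<close> yield the same vector \<open>y\<close>. The
    representation by \<open>\<tau> 1\<close> gives the range and the givens; nonvanishing for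
    \<open>\<pi> r\<close> uses \<open>\<tau> r\<close>, the one consistent with it.\<close>
  have perm: "\<tau> 1 permutes {..<n^2}" and y_eq: "y = permute_vec (\<tau> 1) x"
    and fixed: "\<forall>l\<in>{1..k}. \<tau> 1 (idx l) = idx l"
    using \<tau> by blast+
  have y_nth: "y $ i = x $ inv_into UNIV (\<tau> 1) i" if "i < n^2" for i
    using x that by (simp add: y_eq permute_vec_def)
  have "1 \<le> y $ i \<and> y $ i \<le> int n" if "i < n^2" for i
    using permutes_in_image[OF permutes_inv[OF perm], of i] range that by (simp add: y_nth)
  moreover have "y $ idx l = g (idx l)" if "l \<in> {1..k}" for l
  proof -
    have "idx l < n^2" using subsetD[OF assms(5) imageI[OF that]] by simp
    \<comment> \<open>\<open>permute_vec\<close> reads \<open>x\<close> through the inverse, which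
      has the same fixed points as \<open>\<tau> 1\<close>.\<close>
    moreover have "inv_into UNIV (\<tau> 1) (idx l) = idx l"
      using fixed that permutes_inv_eq[OF perm] by blast
    ultimately show ?thesis
      using givens that by (simp add: y_nth)
  qed
  moreover have "nowhere_zero (permute_cols (\<pi> r) (block_mat n) *\<^sub>v y)" if "r \<in> {1,2,3}" for r
    using nowhere_zero_permute_vec[of "\<pi> r" n "\<tau> r" x] assms(2) \<tau> x nz that by metis
  ultimately show "y \<in> sudoku_solutions n \<pi> k idx g"
    using y by (simp add: sudoku_solutions_def)
qed

end
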